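(* Consider the problem of minimizing $f(x)+g(z)$ subject to $Mx+Nz=0$, $x\in X$, $z\in Z$, with optimal value $p^\star$. Let $\rho>0$, $\sigma>0$, and suppose $f$ is twice continuously differentiable and $\hat L_f$-relatively smooth with respect to its Hessian $H_f$. Run GeNI-ADMM (see context) with $f_1=0$, $f_2=f$, $\eta=\hat L_f$, $\Theta^k=\eta(H_f^k+\sigma I)$ where $H_f^k=H_f(\tilde x^k)$, and $\Psi^k=0$ (NysADMM), with forcing sequences $\{\varepsilon_x^k\},\{\varepsilon_z^k\}$, started with $\tilde u^1=0$ and $M\tilde x^1=-N\tilde z^1$. Assume: (i) there is an optimal primal solution $(x^\star,z^\star)\in X\times Z$ and a $u^\star\in U$ such that $(x^\star,z^\star,u^\star)$ is a saddle point of $L_\rho$ over $(X\times Z)\times U$; (ii) $g$ is finite-valued, convex and lower semicontinuous; (iii) $\mathcal E_x=\sum_{k\ge1}\varepsilon_x^k<\infty$ and $\mathcal E_z=\sum_{k\ge1}\sqrt{\varepsilon_z^k}<\infty$; (iv) there are constants $\theta_{\max},\theta_{\min},\nu>0$ with $\theta_{\max}I\succeq\Theta^k\succeq\theta_{\min}I$ for all $k\ge1$ and $\rho N^TN\succeq\nu I$, and a non-negative summable sequence $\{\zeta^k\}_{k\ge1}$ with $\|\tilde x^k-x^\star\|^2_{\Theta^k}\le(1+\zeta^{k-1})\|\tilde x^k-x^\star\|^2_{\Theta^{k-1}}$ for all $k\ge2$. Put $\tau_\zeta=\prod_{k\ge2}(1+\zeta^k)$, $\mathcal E_\zeta=\tau_\zeta\sum_{k\ge1}\zeta^k$,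 $d_{u^\star}=\|\tilde u^1-u^\star\|$, and for $t\ge1$ let $\bar x^{t+1}=\frac1t\sum_{k=2}^{t+1}\tilde x^k$, $\bar z^{t+1}=\frac1t\sum_{k=2}^{t+1}\tilde z^k$. Then there exist constants $C_x,C_z,C_\zeta>0$, independent of $t$, such that with $$\Gamma=\tfrac12\|\tilde x^1-x^\star\|^2_{\Theta^1}+\tfrac12\|\tilde z^1-z^\star\|^2_{\rho N^TN}+C_x\mathcal E_x+C_z\mathcal E_z+C_\zeta\mathcal E_\zeta$$ one has for every $t\ge1$ $$f(\bar x^{t+1})+g(\bar z^{t+1})-p^\star\le\frac\Gamma t,\qquad\|M\bar x^{t+1}+N\bar z^{t+1}\|\le\frac2t\sqrt{\frac\Gamma\rho+d_{u^\star}^2}.$$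
   Context: Setting. $\mathcal X,\mathcal Z,\mathcal H$ are finite-dimensional real inner-product spaces; $X\subset\mathcal X$, $Z\subset\mathcal Z$ are closed convex sets; $U\subset\mathcal H$ is a closed convex set; $M:\mathcal X\to\mathcal H$, $N:\mathcal Z\to\mathcal H$ are linear operators with adjoints $M^T,N^T$; $f$ is a smooth (Lipschitz gradient) convex function on $\mathcal X$. "psd" means symmetric positive semidefinite; $A\preceq B$ means $B-A$ is psd; $\|v\|_A^2=\langle v,Av\rangle$. Lagrangian: $L_\rho(x,z,u)=f(x)+g(z)+\langle\rho u,Mx+Nz\rangle$; $(x^\star,z^\star,u^\star)$ is a saddle point if $L_\rho(x^\star,z^\star,u)\le L_\rho(x^\star,z^\star,u^\star)\le L_\rho(x,z,u^\star)$ for all $x\in X,z\in Z,u\in U$. Relative smoothness: $f$ is $\hat L_f$-relatively smooth with respect to its Hessian $H_f$ if $\hat L_f>0$ and $f(x)\le f(y)+\langle\nabla f(y),x-y\rangle+\frac{\hat L_f}2\|x-y\|^2_{H_f(y)}$ for all $x,y\in X$. GeNI-ADMM with $f_1=0$, $f_2=f$, $\Psi^k=0$: given $\tilde x^1\in X,\tilde z^1\in Z,\tilde u^1\in\mathcal H$, psd $\Theta^k$, and non-negative forcing sequences, for $k=1,2,\dots$ choose: - $\tilde x^{k+1}\in X$ with $\|\tilde x^{k+1}-x^{k+1}_{\rm ex}\|\le\varepsilon_x^k$, where $x^{k+1}_{\rm ex}$ is the exact minimizer over $x\in X$ of $\langle\nabla f(\tilde x^k),x-\tilde x^k\rangle+\frac12\|x-\tilde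 x^k\|^2_{\Theta^k}+\frac\rho2\|Mx+N\tilde z^k+\tilde u^k\|^2$; - $\tilde z^{k+1}\in Z$ whose objective value is within $\varepsilon_z^k$ of the minimum over $z\in Z$ of $g(z)+\frac\rho2\|M\tilde x^{k+1}+Nz+\tilde u^k\|^2$; - $\tilde u^{k+1}=\tilde u^k+M\tilde x^{k+1}+N\tilde z^{k+1}$. *)

theory Defs
  imports "HOL-Analysis.Analysis"
begin

definition psd :: "('a::real_inner \<Rightarrow> 'a) \<Rightarrow> bool" where
  "psd A \<longleftrightarrow> linear A \<and> (\<forall>v w. A v \<bullet> w = v \<bullet> A w) \<and> (\<forall>v. 0 \<le> v \<bullet> A v)"

definition loewner_le :: "('a::real_inner \<Rightarrow> 'a) \<Rightarrow> ('a \<Rightarrow> 'a) \<Rightarrow> bool" (infix "\<preceq>" 50) where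
  "A \<preceq> B \<longleftrightarrow> psd (\<lambda>v. B v - A v)"

definition wnorm_sq :: "('a::real_inner \<Rightarrow> 'a) \<Rightarrow> 'a \<Rightarrow> real" where
  "wnorm_sq A v = v \<bullet> A v"

definition lsc_on :: "'a::topological_space set \<Rightarrow> ('a \<Rightarrow> real) \<Rightarrow> bool" where
  "lsc_on S g \<longleftrightarrow> (\<forall>x\<in>S. \<forall>c<g x. \<forall>\<^sub>F y in at x within S. c < g y)"

text \<open>The gradient and the Hessian are uniquely determined by \<open>f\<close>; continuity of the
  Hessian is with respect to the operator norm.\<close>

definition twice_cont_diff ::
  "('x::euclidean_space \<Rightarrow> real) \<Rightarrow> ('x \<Rightarrow> 'x) \<Rightarrow> ('x \<Rightarrow> 'x \<Rightarrow>\<^sub>L 'x) \<Rightarrow> bool" where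
  "twice_cont_diff f gradf Hf \<longleftrightarrow>
     (\<forall>x. GDERIV f x :> gradf x) \<and>
     (\<forall>x. (gradf has_derivative blinfun_apply (Hf x)) (at x)) \<and>
     continuous_on UNIV Hf"

definition relatively_smooth ::
  "'x::euclidean_space set \<Rightarrow> ('x \<Rightarrow> real) \<Rightarrow> ('x \<Rightarrow> 'x) \<Rightarrow> ('x \<Rightarrow> 'x \<Rightarrow>\<^sub>L 'x) \<Rightarrow> real \<Rightarrow> bool" where
  "relatively_smooth X f gradf Hf Lf \<longleftrightarrow>
     Lf > 0 \<and>
     (\<forall>x\<in>X. \<forall>y\<in>X. f x \<le> f y + gradf y \<bullet> (x - y) + Lf / 2 * wnorm_sq (blinfun_apply (Hf y)) (x - y))"

definition feasible ::
  "'x::euclidean_space set \<Rightarrow> 'z::euclidean_space set \<Rightarrow> ('x \<Rightarrow> 'h::euclidean_space) \<Rightarrow> ('z \<Rightarrow> 'h)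
   \<Rightarrow> ('x \<times> 'z) set" where
  "feasible X Z M N = {(x, z). x \<in> X \<and> z \<in> Z \<and> M x + N z = 0}"

definition primal_optimal ::
  "'x::euclidean_space set \<Rightarrow> 'z::euclidean_space set \<Rightarrow> ('x \<Rightarrow> 'h::euclidean_space) \<Rightarrow> ('z \<Rightarrow> 'h)
   \<Rightarrow> ('x \<Rightarrow> real) \<Rightarrow> ('z \<Rightarrow> real) \<Rightarrow> 'x \<Rightarrow> 'z \<Rightarrow> bool" where
  "primal_optimal X Z M N f g xs zs \<longleftrightarrow>
     is_arg_min (\<lambda>(x, z). f x + g z) (\<lambda>p. p \<in> feasible X Z M N) (xs, zs)"

definition opt_value ::
  "'x::euclidean_space set \<Rightarrow> 'z::euclidean_space set \<Rightarrow> ('x \<Rightarrow> 'h::euclidean_space) \<Rightarrow> ('z \<Rightarrow> 'h)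
   \<Rightarrow> ('x \<Rightarrow> real) \<Rightarrow> ('z \<Rightarrow> real) \<Rightarrow> real" where
  "opt_value X Z M N f g = (INF (x, z) \<in> feasible X Z M N. f x + g z)"

definition lagrangian ::
  "('x \<Rightarrow> 'h::real_inner) \<Rightarrow> ('z \<Rightarrow> 'h) \<Rightarrow> ('x \<Rightarrow> real) \<Rightarrow> ('z \<Rightarrow> real) \<Rightarrow> real
   \<Rightarrow> 'x \<Rightarrow> 'z \<Rightarrow> 'h \<Rightarrow> real" where
  "lagrangian M N f g \<rho> x z u = f x + g z + (\<rho> *\<^sub>R u) \<bullet> (M x + N z)"

definition saddle_point ::
  "'x set \<Rightarrow> 'z set \<Rightarrow> 'h set \<Rightarrow> ('x \<Rightarrow> 'z \<Rightarrow> 'h \<Rightarrow> real) \<Rightarrow> 'x \<Rightarrow> 'z \<Rightarrow> 'h \<Rightarrow> bool" where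
  "saddle_point X Z U L xs zs us \<longleftrightarrow>
     xs \<in> X \<and> zs \<in> Z \<and> us \<in> U \<and>
     (\<forall>x\<in>X. \<forall>z\<in>Z. \<forall>u\<in>U. L xs zs u \<le> L xs zs us \<and> L xs zs us \<le> L x z us)"

definition x_objective ::
  "('x::euclidean_space \<Rightarrow> 'h::euclidean_space) \<Rightarrow> ('z::euclidean_space \<Rightarrow> 'h) \<Rightarrow> ('x \<Rightarrow> 'x) \<Rightarrow> real
   \<Rightarrow> ('x \<Rightarrow> 'x) \<Rightarrow> 'x \<Rightarrow> 'z \<Rightarrow> 'h \<Rightarrow> 'x \<Rightarrow> real" where
  "x_objective M N gradf \<rho> \<Theta> xk zk uk x =
     gradf xk \<bullet> (x - xk) + 1/2 * wnorm_sq \<Theta> (x - xk) + \<rho>/2 * (norm (M x + N zk + uk))\<^sup>2"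

definition z_objective ::
  "('x::euclidean_space \<Rightarrow> 'h::euclidean_space) \<Rightarrow> ('z::euclidean_space \<Rightarrow> 'h) \<Rightarrow> ('z \<Rightarrow> real) \<Rightarrow> real
   \<Rightarrow> 'x \<Rightarrow> 'h \<Rightarrow> 'z \<Rightarrow> real" where
  "z_objective M N g \<rho> xn uk z = g z + \<rho>/2 * (norm (M xn + N z + uk))\<^sup>2"

text \<open>Runs of GeNI-ADMM with \<open>f\<^sub>1 = 0\<close>, \<open>f\<^sub>2 = f\<close> and \<open>\<Psi>\<^sup>k = 0\<close>. All sequences are indexed from 1;
  their values at 0 are irrelevant.\<close>

definition geni_admm ::
  "'x::euclidean_space set \<Rightarrow> 'z::euclidean_space set \<Rightarrow> ('x \<Rightarrow> 'h::euclidean_space) \<Rightarrow> ('z \<Rightarrow> 'h)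
   \<Rightarrow> ('x \<Rightarrow> 'x) \<Rightarrow> ('z \<Rightarrow> real) \<Rightarrow> real \<Rightarrow> (nat \<Rightarrow> 'x \<Rightarrow> 'x) \<Rightarrow> (nat \<Rightarrow> real) \<Rightarrow> (nat \<Rightarrow> real)
   \<Rightarrow> (nat \<Rightarrow> 'x) \<Rightarrow> (nat \<Rightarrow> 'z) \<Rightarrow> (nat \<Rightarrow> 'h) \<Rightarrow> bool" where
  "geni_admm X Z M N gradf g \<rho> \<Theta> \<epsilon>x \<epsilon>z x z u \<longleftrightarrow>
     x 1 \<in> X \<and> z 1 \<in> Z \<and>
     (\<forall>k\<ge>1.
        psd (\<Theta> k) \<and> 0 \<le> \<epsilon>x k \<and> 0 \<le> \<epsilon>z k \<and>
        x (k + 1) \<in> X \<and>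
        (\<exists>xex. is_arg_min (x_objective M N gradf \<rho> (\<Theta> k) (x k) (z k) (u k)) (\<lambda>y. y \<in> X) xex \<and>
               norm (x (k + 1) - xex) \<le> \<epsilon>x k) \<and>
        z (k + 1) \<in> Z \<and>
        (\<exists>zex. is_arg_min (z_objective M N g \<rho> (x (k + 1)) (u k)) (\<lambda>y. y \<in> Z) zex \<and>
               z_objective M N g \<rho> (x (k + 1)) (u k) (z (k + 1))
                 \<le> z_objective M N g \<rho> (x (k + 1)) (u k) zex + \<epsilon>z k) \<and>
        u (k + 1) = u k + M (x (k + 1)) + N (z (k + 1)))"

definition nys_metric :: "real \<Rightarrow> real \<Rightarrow> ('x::euclidean_space \<Rightarrow>\<^sub>L 'x) \<Rightarrow> 'x \<Rightarrow> 'x" where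
  "nys_metric \<eta> \<sigma> H v = \<eta> *\<^sub>R (blinfun_apply H v + \<sigma> *\<^sub>R v)"

definition avg :: "(nat \<Rightarrow> 'a::real_vector) \<Rightarrow> nat \<Rightarrow> 'a" where
  "avg s t = (1 / real t) *\<^sub>R (\<Sum>k = 2..t + 1. s k)"

end

theory Submission
  imports Defs
begin

text \<open>
  Relative smoothness, convexity and the optimality conditions of the two subproblems show that
  \<open>D\<^sup>k(v) = \<parallel>x\<^sup>k - x\<^sup>\<star>\<parallel>\<^sup>2/2\<close> (in the metric \<open>\<Theta>\<^sup>k\<close>) \<open>+ \<rho>/2 \<parallel>N(z\<^sup>k - z\<^sup>\<star>)\<parallel>\<^sup>2 + \<rho>/2 \<parallel>u\<^sup>k - v\<parallel>\<^sup>2\<close>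
  decreases, for every dual point \<open>v\<close>, by at least the Lagrangian gap at \<open>v\<close>, up to an error of at most
  \<open>A b\<^sup>k (1 + D\<^sup>k + D\<^bsup>k+1\<^esup>)\<close> with \<open>b\<^sup>k = \<epsilon>\<^sub>x\<^sup>k + \<surd>\<epsilon>\<^sub>z\<^sup>k + \<zeta>\<^sup>k\<close> summable and \<open>D\<^sup>k = D\<^sup>k(u\<^sup>\<star>)\<close>.
  For \<open>v = u\<^sup>\<star>\<close> the gap is nonnegative, so \<open>D\<^sup>k\<close> is bounded and the total error is at most
  \<open>C \<Sum> b\<^sup>k\<close>. Telescoping with \<open>v = 0\<close> and Jensen's inequality bound the objective; telescoping with
  \<open>v = u\<^sup>\<star>\<close> bounds \<open>u\<^bsup>t+1\<^esup>\<close>, and hence the residual, since the multiplier update makes the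
  averaged residual equal to \<open>(u\<^bsup>t+1\<^esup> - u\<^sup>1)/t\<close>.
\<close>

text \<open>Restricted to the line through \<open>x\<close> and \<open>y\<close>, this is the
  tangent inequality for a convex function of one real variable; the chain rule supplies the slope
  at 0.\<close>

lemma convex_on_above_gradient:
  fixes f :: "'a::real_inner \<Rightarrow> real"
  assumes "convex_on UNIV f" "GDERIV f x :> d"
  shows "f x + d \<bullet> (y - x) \<le> f y"
proof -
  define h where "h t = f (x + t *\<^sub>R (y - x))" for t
  have "convex_on UNIV h"
  proof (rule convex_onI)
    fix t a b :: real
    assume t: "0 < t" "t < 1"
    have "x + ((1 - t) *\<^sub>R a + t *\<^sub>R b) *\<^sub>R (y - x)
        = (1 - t) *\<^sub>R (x + a *\<^sub>R (y - x)) + t *\<^sub>R (x + b *\<^sub>R (y - x))"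
      by (simp add: algebra_simps)
    then show "h ((1 - t) *\<^sub>R a + t *\<^sub>R b) \<le> (1 - t) * h a + t * h b"
      unfolding h_def using convex_onD[OF assms(1), of t] t by simp
  qed simp
  moreover have "(h has_real_derivative d \<bullet> (y - x)) (at 0)"
  proof -
    have "(f has_derivative (\<lambda>v. v \<bullet> d)) (at (x + 0 *\<^sub>R (y - x)))"
      using assms(2) by (simp add: gderiv_def)
    moreover have "((\<lambda>t. x + t *\<^sub>R (y - x)) has_derivative (\<lambda>t. t *\<^sub>R (y - x))) (at 0)"
      by (auto intro!: derivative_eq_intros)
    ultimately have "(h has_derivative (\<lambda>t. (t *\<^sub>R (y - x)) \<bullet> d)) (at 0)"
      unfolding h_def by (rule has_derivative_compose[rotated])
    moreover have "(\<lambda>t. (t *\<^sub>R (y - x)) \<bullet> d) = (*) (d \<bullet> (y - x))"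
      by (auto simp: fun_eq_iff inner_commute)
    ultimately show ?thesis by (simp add: has_field_derivative_def)
  qed
  ultimately have "h 1 - h 0 \<ge> (d \<bullet> (y - x)) * (1 - 0)"
    by (intro convex_on_imp_above_tangent[where A = UNIV]) auto
  then show ?thesis by (simp add: h_def)
qed

text \<open>Divide by \<open>t\<close> and let \<open>t\<close> tend to 0. This turns minimality
  along a segment into a first-order condition.\<close>

lemma nonneg_if_quadratic_nonneg:
  fixes a b :: real
  assumes "\<And>t. 0 < t \<Longrightarrow> t \<le> 1 \<Longrightarrow> 0 \<le> t * a + t\<^sup>2 * b"
  shows "0 \<le> a"
proof (rule ccontr)
  assume "\<not> 0 \<le> a"
  \<comment> \<open>If \<open>a < 0\<close>, this choice keeps \<open>t * \<bar>b\<bar>\<close>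
    below \<open>- a / 2\<close>, so the linear term wins and \<open>a + t * b\<close> is
    negative.\<close>
  define q where "q = 2 * (\<bar>b\<bar> + 1)"
  define t where "t = min 1 (- a / q)"
  have "0 < q" by (simp add: q_def)
  then have "t * q \<le> - a / q * q" unfolding t_def by (intro mult_right_mono) auto
  then have t: "0 < t" "t \<le> 1" "t * (2 * (\<bar>b\<bar> + 1)) \<le> - a"
    using \<open>\<not> 0 \<le> a\<close> \<open>0 < q\<close> by (auto simp: t_def q_def divide_neg_pos)
  have "0 \<le> t * (a + t * b)"
    using assms[OF t(1,2)] by (simp add: power2_eq_square algebra_simps)
  then have "0 \<le> a + t * b" using t(1) by (simp add: zero_le_mult_iff)
  moreover have "t * b \<le> t * \<bar>b\<bar>" using t by (intro mult_left_mono) auto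
  moreover have "t * (2 * (\<bar>b\<bar> + 1)) = 2 * (t * \<bar>b\<bar>) + 2 * t" by (simp add: algebra_simps)
  ultimately show False using t \<open>\<not> 0 \<le> a\<close> by linarith
qed

text \<open>Counterpart of the previous lemma for approximate minimality: since \<open>t\<close>
  cannot be sent to 0 against a fixed error \<epsilon>, the first-order condition survives only up
  to order \<open>sqrt \<epsilon>\<close>. Hence the square roots of \<open>\<epsilon>z k\<close> in
  the error sum.\<close>

lemma le_sqrt_if_quadratic_le:
  fixes a b c \<epsilon> :: real
  assumes le: "\<And>t. 0 < t \<Longrightarrow> t \<le> 1 \<Longrightarrow> t * a \<le> t\<^sup>2 * b + \<epsilon>"
    and "0 \<le> b" "0 \<le> \<epsilon>" "sqrt \<epsilon> \<le> c" "1 \<le> c"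
  shows "a \<le> sqrt \<epsilon> * (b + c)"
proof (cases "\<epsilon> = 0")
  case True
  have "0 \<le> - a"
  proof (rule nonneg_if_quadratic_nonneg)
    show "0 \<le> t * - a + t\<^sup>2 * b" if "0 < t" "t \<le> 1" for t using le[OF that] True by simp
  qed
  with True show ?thesis by simp
next
  case False
  define s where "s = sqrt \<epsilon>"
  \<comment> \<open>The step \<open>t = s / c\<close> balances the two error terms \<open>t * b\<close> and \<open>\<epsilon> / t\<close>; \<open>c\<close> only keeps it below 1.\<close>
  have s: "0 < s" "\<epsilon> = s\<^sup>2" "s \<le> c" using False assms by (auto simp: s_def)
  have "s / c * a \<le> (s / c)\<^sup>2 * b + s\<^sup>2"
    using le[of "s / c"] s assms(5) by simp
  then have "s / c * a \<le> s / c * (s / c * b + s * c)"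
    using s assms(5) by (simp add: field_simps power2_eq_square)
  then have "a \<le> s / c * b + s * c"
    using s assms(5) by (subst (asm) mult_le_cancel_left_pos) auto
  also have "s / c * b \<le> s * b"
    using s assms by (intro mult_right_mono) (auto simp: field_simps)
  finally show ?thesis by (simp add: s_def algebra_simps)
qed

text \<open>Cauchy-Schwarz for the semidefinite form of \<open>A\<close>, whose diagonal values are
  at most \<theta> times the squared norm.\<close>

lemma psd_inner_le:
  assumes "psd A" "A \<preceq> (\<lambda>v. \<theta> *\<^sub>R v)"
  shows "A v \<bullet> w \<le> \<theta> * (norm v * norm w)"
proof (cases "v = 0 \<or> w = 0")
  case True
  have "A 0 = 0" using assms(1) by (simp add: psd_def linear_0)
  with True show ?thesis by auto
next
  case False
  have lin: "linear A" and sym: "\<And>a b. A a \<bullet> b = a \<bullet> A b" and pos: "\<And>a. 0 \<le> a \<bullet> A a"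
    using assms(1) by (auto simp: psd_def)
  have ub: "a \<bullet> A a \<le> \<theta> * (norm a)\<^sup>2" for a
    using assms(2) by (simp add: loewner_le_def psd_def inner_diff_right power2_norm_eq_inner)
  \<comment> \<open>Cross-scaling gives both vectors the norm \<open>norm v * norm w\<close>, so
    that expanding the form at \<open>a - b\<close> yields a product bound and not merely a sum of
    squares.\<close>
  define a b where "a = norm w *\<^sub>R v" and "b = norm v *\<^sub>R w"
  have "0 \<le> (a - b) \<bullet> A (a - b)" by (rule pos)
  also have "\<dots> = a \<bullet> A a - 2 * (A a \<bullet> b) + b \<bullet> A b"
    using sym[of a b] sym[of b a]
    by (simp add: linear_diff[OF lin] inner_diff_left inner_diff_right inner_commute)
  finally have "2 * (A a \<bullet> b) \<le> \<theta> * (norm a)\<^sup>2 + \<theta> * (norm b)\<^sup>2" using ub[of a] ub[of b] by simp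
  then have "(norm v * norm w) * (A v \<bullet> w) \<le> (norm v * norm w) * (\<theta> * (norm v * norm w))"
    by (simp add: a_def b_def linear_cmul[OF lin] power2_eq_square algebra_simps)
  then show ?thesis using False by (subst (asm) mult_le_cancel_left_pos) auto
qed

text \<open>A discrete Gronwall argument. \<open>D (Suc k)\<close> also occurs on the right and can
  be absorbed only where \<open>a k\<close> is small, which summability grants from some index
  on.\<close>

lemma perturbed_recursion_bounded:
  fixes D a :: "nat \<Rightarrow> real"
  assumes D: "\<And>k. 0 \<le> D k" and a: "\<And>k. 0 \<le> a k" "summable a"
    and rec: "\<And>k. D (Suc k) \<le> D k + a k * (1 + D k + D (Suc k))"
  obtains B where "\<And>k. D k \<le> B"
proof -
  obtain K where "\<forall>k\<ge>K. a k < 1/2"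
    using order_tendstoD(2)[OF summable_LIMSEQ_zero[OF a(2)], of "1/2"]
    unfolding eventually_sequentially by auto
  then have K: "\<And>k. k \<ge> K \<Longrightarrow> a k \<le> 1/2" by (simp add: less_imp_le)
  \<comment> \<open>For \<open>a k \<le> 1/2\<close> the growth factor satisfies
    \<open>(1 + a k) / (1 - a k) \<le> 1 + 4 * a k \<le> exp (4 * a k)\<close>; exponentials turn
    the product of the factors into a convergent sum.\<close>
  have step: "1 + D (Suc k) \<le> exp (4 * a k) * (1 + D k)" if "k \<ge> K" for k
  proof -
    have "(1 - a k) * (1 + D (Suc k)) \<le> (1 + a k) * (1 + D k)"
      using rec[of k] a(1)[of k] by (simp add: algebra_simps)
    also have "\<dots> \<le> ((1 - a k) * (1 + 4 * a k)) * (1 + D k)"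
    proof (rule mult_right_mono)
      have "a k * a k \<le> a k * (1/2)" using K[OF that] a(1) by (intro mult_left_mono)
      then show "1 + a k \<le> (1 - a k) * (1 + 4 * a k)" by (simp add: algebra_simps)
    qed (use D[of k] in simp)
    also have "\<dots> = (1 - a k) * ((1 + 4 * a k) * (1 + D k))" by simp
    finally have "1 + D (Suc k) \<le> (1 + 4 * a k) * (1 + D k)"
      using K[OF that] by (subst (asm) mult_le_cancel_left_pos) auto
    also have "\<dots> \<le> exp (4 * a k) * (1 + D k)"
      using D[of k] by (intro mult_right_mono exp_ge_add_one_self) auto
    finally show ?thesis .
  qed
  have head: "1 + D (K + n) \<le> exp (4 * (\<Sum>k<n. a (K + k))) * (1 + D K)" for n
  proof (induction n)
    case (Suc n)
    have "1 + D (K + Suc n) \<le> exp (4 * a (K + n)) * (1 + D (K + n))"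
      using step[of "K + n"] by simp
    also have "\<dots> \<le> exp (4 * a (K + n)) * (exp (4 * (\<Sum>k<n. a (K + k))) * (1 + D K))"
      using Suc by (intro mult_left_mono) auto
    finally show ?case by (simp add: exp_add algebra_simps)
  qed simp
  have "(\<Sum>k<n. a (K + k)) \<le> (\<Sum>k. a (K + k))" for n
    using a by (intro sum_le_suminf) (auto simp: add.commute[of K] summable_iff_shift)
  then have tail: "1 + D (K + n) \<le> exp (4 * (\<Sum>k. a (K + k))) * (1 + D K)" for n
    using D[of K] by (intro order_trans[OF head mult_right_mono]) auto
  \<comment> \<open>The Gronwall bound starts at \<open>K\<close>; the sum covers the finitely many
    earlier values.\<close>
  define B where "B = exp (4 * (\<Sum>k. a (K + k))) * (1 + D K) + (\<Sum>k<K. D k)"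
  have "D k \<le> B" for k
  proof (cases "k < K")
    case True
    then have "D k \<le> (\<Sum>k<K. D k)" using D by (intro member_le_sum) auto
    moreover have "0 \<le> exp (4 * (\<Sum>k. a (K + k))) * (1 + D K)" using D[of K] by simp
    ultimately show ?thesis by (simp add: B_def)
  next
    case False
    moreover have "0 \<le> (\<Sum>k<K. D k)" using D by (simp add: sum_nonneg)
    ultimately show ?thesis using tail[of "k - K"] by (simp add: B_def)
  qed
  then show thesis by (rule that)
qed

text \<open>The first-order condition holds at the exact minimizer \<open>xex\<close>, not at
  \<open>xn\<close>. Moving it to \<open>xn\<close> and dropping the nonnegative quadratic terms in
  \<open>xn - xex\<close> leaves an error in which every term has a factor
  \<open>xn - xex\<close>.\<close>

lemma inexact_x_step:
  fixes M :: "'x::euclidean_space \<Rightarrow> 'h::euclidean_space" and N :: "'z::euclidean_space \<Rightarrow> 'h"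
    and xn :: 'x
  assumes "psd \<Theta>" "linear M" "convex X" "0 \<le> \<rho>" "y \<in> X"
    and min: "is_arg_min (x_objective M N gradf \<rho> \<Theta> xk zk uk) (\<lambda>y. y \<in> X) xex"
  defines "G \<equiv> \<lambda>d. gradf xk \<bullet> d + \<Theta> (xn - xk) \<bullet> d + \<rho> * ((M xn + N zk + uk) \<bullet> M d)"
  shows "G (xn - y) \<le> G (xn - xex) + \<Theta> (xn - xex) \<bullet> (xn - y) + \<rho> * (M (xn - xex) \<bullet> M (xn - y))"
proof -
  have lin: "linear \<Theta>" and sym: "\<And>a b. \<Theta> a \<bullet> b = a \<bullet> \<Theta> b" and pos: "\<And>a. 0 \<le> a \<bullet> \<Theta> a"
    using assms(1) by (auto simp: psd_def)
  define d e where "d = y - xex" and "e = xex - xk"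
  define w where "w = M xex + N zk + uk"
  define \<delta> where "\<delta> = xn - xex"
  \<comment> \<open>First-order optimality at \<open>xex\<close> in the direction of
    \<open>y\<close>, read off from the exact quadratic expansion of the objective along the
    segment.\<close>
  have var: "0 \<le> gradf xk \<bullet> d + \<Theta> e \<bullet> d + \<rho> * (w \<bullet> M d)"
  proof (rule nonneg_if_quadratic_nonneg)
    fix t :: real assume t: "0 < t" "t \<le> 1"
    have "xex \<in> X" using min by (simp add: is_arg_min_def)
    then have "(1 - t) *\<^sub>R xex + t *\<^sub>R y \<in> X"
      using assms(3,5) t by (intro convexD) auto
    then have "xex + t *\<^sub>R d \<in> X" by (simp add: d_def algebra_simps)
    then have "x_objective M N gradf \<rho> \<Theta> xk zk uk xex \<le> x_objective M N gradf \<rho> \<Theta> xk zk uk (xex + t *\<^sub>R d)"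
      using min by (auto simp: is_arg_min_def not_less)
    moreover have "xex + t *\<^sub>R d - xk = e + t *\<^sub>R d" by (simp add: e_def)
    moreover have "M (xex + t *\<^sub>R d) + N zk + uk = w + t *\<^sub>R M d"
      by (simp add: w_def linear_add[OF assms(2)] linear_cmul[OF assms(2)])
    ultimately have "gradf xk \<bullet> e + 1/2 * (e \<bullet> \<Theta> e) + \<rho>/2 * (w \<bullet> w)
       \<le> gradf xk \<bullet> (e + t *\<^sub>R d) + 1/2 * ((e + t *\<^sub>R d) \<bullet> \<Theta> (e + t *\<^sub>R d))
         + \<rho>/2 * ((w + t *\<^sub>R M d) \<bullet> (w + t *\<^sub>R M d))"
      unfolding x_objective_def wnorm_sq_def power2_norm_eq_inner by (simp add: w_def e_def)
    also have "\<dots> = gradf xk \<bullet> e + 1/2 * (e \<bullet> \<Theta> e) + \<rho>/2 * (w \<bullet> w)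
       + (t * (gradf xk \<bullet> d + \<Theta> e \<bullet> d + \<rho> * (w \<bullet> M d))
          + t\<^sup>2 * (1/2 * (d \<bullet> \<Theta> d) + \<rho>/2 * (M d \<bullet> M d)))"
      using sym[of e d] sym[of d e]
      by (simp add: linear_add[OF lin] linear_cmul[OF lin] inner_simps inner_commute
          power2_eq_square field_simps)
    finally show "0 \<le> t * (gradf xk \<bullet> d + \<Theta> e \<bullet> d + \<rho> * (w \<bullet> M d))
          + t\<^sup>2 * (1/2 * (d \<bullet> \<Theta> d) + \<rho>/2 * (M d \<bullet> M d))" by simp
  qed
  have eqs: "xn - y = \<delta> - d" "xn - xk = e + \<delta>" "M xn + N zk + uk = w + M \<delta>"
    by (simp_all add: \<delta>_def d_def e_def w_def linear_diff[OF assms(2)])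
  have pos\<delta>: "0 \<le> \<Theta> \<delta> \<bullet> \<delta>" "0 \<le> \<rho> * (M \<delta> \<bullet> M \<delta>)"
    using pos[of \<delta>] assms(4) by (simp_all add: inner_commute)
  show ?thesis
    using var pos\<delta> unfolding G_def \<delta>_def[symmetric] eqs
    by (simp add: linear_add[OF lin] linear_diff[OF assms(2)] inner_simps algebra_simps)
qed

text \<open>No derivative of \<open>g\<close> is available, so \<open>zn\<close> is compared with
  the points of the segment to \<open>y\<close>. Convexity bounds \<open>g\<close> there and the
  penalty is quadratic in the step length, so the balancing argument applies.\<close>

lemma inexact_z_step:
  fixes M :: "'x::euclidean_space \<Rightarrow> 'h::euclidean_space" and N :: "'z::euclidean_space \<Rightarrow> 'h"
  assumes "linear N" "convex_on Z g" "0 \<le> \<rho>" "zn \<in> Z" "y \<in> Z"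
    and le: "\<And>w. w \<in> Z \<Longrightarrow> z_objective M N g \<rho> xn uk zn \<le> z_objective M N g \<rho> xn uk w + \<epsilon>"
    and "0 \<le> \<epsilon>" "sqrt \<epsilon> \<le> c" "1 \<le> c"
  shows "g zn - g y + \<rho> * ((uk + M xn + N zn) \<bullet> N (zn - y))
     \<le> sqrt \<epsilon> * (\<rho>/2 * (norm (N (zn - y)))\<^sup>2 + c)"
proof (rule le_sqrt_if_quadratic_le)
  fix t :: real assume t: "0 < t" "t \<le> 1"
  define v w where "v = N (zn - y)" and "w = uk + M xn + N zn"
  define p where "p = (1 - t) *\<^sub>R zn + t *\<^sub>R y"
  have "p \<in> Z"
    unfolding p_def using convex_on_imp_convex[OF assms(2)] assms(4,5) t by (intro convexD) auto
  then have min: "g zn + \<rho>/2 * (norm (M xn + N zn + uk))\<^sup>2 \<le> g p + \<rho>/2 * (norm (M xn + N p + uk))\<^sup>2 + \<epsilon>"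
    using le by (simp add: z_objective_def)
  have "g p \<le> (1 - t) * g zn + t * g y"
    unfolding p_def using t assms by (intro convex_onD[OF assms(2)]) auto
  moreover have w: "M xn + N zn + uk = w" "M xn + N p + uk = w - t *\<^sub>R v"
    by (simp_all add: w_def p_def v_def linear_add[OF assms(1)] linear_diff[OF assms(1)]
        linear_cmul[OF assms(1)] algebra_simps)
  moreover have sq: "(norm (w - t *\<^sub>R v))\<^sup>2 = (norm w)\<^sup>2 - 2 * t * (w \<bullet> v) + t\<^sup>2 * (norm v)\<^sup>2"
    unfolding power2_norm_eq_inner by (simp add: inner_simps inner_commute power2_eq_square algebra_simps)
  ultimately show "t * (g zn - g y + \<rho> * ((uk + M xn + N zn) \<bullet> N (zn - y)))
      \<le> t\<^sup>2 * (\<rho>/2 * (norm (N (zn - y)))\<^sup>2) + \<epsilon>"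
    using min[unfolded w sq] unfolding v_def[symmetric] w_def[symmetric] by (simp add: algebra_simps)
qed (use assms in auto)

text \<open>A three-point identity handles the \<Theta>-norms, and completing a square handles the
  multiplier and the \<open>N\<close> terms. The dual point \<open>v\<close> stays free because it
  does not occur in the two subproblem errors.\<close>

lemma lyapunov_step:
  fixes M :: "'x::real_inner \<Rightarrow> 'h::real_inner" and N :: "'z::real_inner \<Rightarrow> 'h"
  assumes "psd \<Theta>" "linear M" "linear N" "0 \<le> \<rho>" "M xs + N zs = 0" "un = uk + M xn + N zn"
    and f: "fgap \<le> d \<bullet> (xn - xs) + 1/2 * wnorm_sq \<Theta> (xn - xk)"
    and x: "d \<bullet> (xn - xs) + \<Theta> (xn - xk) \<bullet> (xn - xs) + \<rho> * ((M xn + N zk + uk) \<bullet> M (xn - xs)) \<le> ex"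
    and z: "ggap + \<rho> * (un \<bullet> N (zn - zs)) \<le> ez"
  shows "fgap + ggap + \<rho> * (v \<bullet> (M xn + N zn))
     \<le> 1/2 * wnorm_sq \<Theta> (xk - xs) + \<rho>/2 * (norm (N (zk - zs)))\<^sup>2 + \<rho>/2 * (norm (uk - v))\<^sup>2
       - (1/2 * wnorm_sq \<Theta> (xn - xs) + \<rho>/2 * (norm (N (zn - zs)))\<^sup>2 + \<rho>/2 * (norm (un - v))\<^sup>2)
       + ex + ez"
proof -
  have lin: "linear \<Theta>" and sym: "\<And>a b. \<Theta> a \<bullet> b = a \<bullet> \<Theta> b"
    using assms(1) by (auto simp: psd_def)
  define p q where "p = xn - xs" and "q = xk - xs"
  define a b r where "a = N (zk - zs)" and "b = N (zn - zs)" and "r = M xn + N zn"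
  \<comment> \<open>The square of \<open>xn - xk\<close> arising here cancels the one in the upper
    bound on \<open>fgap\<close>.\<close>
  have three_point: "\<Theta> (xn - xk) \<bullet> p
      = 1/2 * wnorm_sq \<Theta> (xn - xk) + 1/2 * wnorm_sq \<Theta> p - 1/2 * wnorm_sq \<Theta> q"
  proof -
    have pq: "xn - xk = p - q" by (simp add: p_def q_def)
    show ?thesis
      unfolding pq wnorm_sq_def using sym[of p q] sym[of q p]
      by (simp add: linear_diff[OF lin] inner_diff_left inner_diff_right inner_commute field_simps)
  qed
  have "M xs = - N zs" using assms(5) by (simp add: eq_neg_iff_add_eq_0)
  then have Mp: "M p = r - b"
    by (simp add: p_def r_def b_def linear_diff[OF assms(2)] linear_diff[OF assms(3)])
  have w: "M xn + N zk + uk = un + a - b"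
    by (simp add: assms(6) a_def b_def linear_diff[OF assms(3)])
  have uk: "uk = un - r" by (simp add: assms(6) r_def)
  \<comment> \<open>The slack of the estimate is exactly one square, that of
    \<open>a - b + r = M xn + N zk\<close>, and is discarded.\<close>
  have "(norm a)\<^sup>2 - (norm b)\<^sup>2 + (norm (uk - v))\<^sup>2 - (norm (un - v))\<^sup>2
      - 2 * (v \<bullet> r - (un + a - b) \<bullet> (r - b) - un \<bullet> b) = (norm (a - b + r))\<^sup>2"
    unfolding uk power2_norm_eq_inner
    by (simp add: inner_diff_left inner_diff_right inner_add_left inner_add_right inner_commute)
  then have "2 * (v \<bullet> r - (un + a - b) \<bullet> (r - b) - un \<bullet> b)
      \<le> (norm a)\<^sup>2 - (norm b)\<^sup>2 + (norm (uk - v))\<^sup>2 - (norm (un - v))\<^sup>2"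
    using zero_le_power2[of "norm (a - b + r)"] by linarith
  then have "\<rho>/2 * (2 * (v \<bullet> r - (un + a - b) \<bullet> (r - b) - un \<bullet> b))
      \<le> \<rho>/2 * ((norm a)\<^sup>2 - (norm b)\<^sup>2 + (norm (uk - v))\<^sup>2 - (norm (un - v))\<^sup>2)"
    using assms(4) by (intro mult_left_mono) auto
  then have "\<rho> * (v \<bullet> r) - \<rho> * ((un + a - b) \<bullet> (r - b)) - \<rho> * (un \<bullet> b)
      \<le> \<rho>/2 * (norm a)\<^sup>2 - \<rho>/2 * (norm b)\<^sup>2 + \<rho>/2 * (norm (uk - v))\<^sup>2 - \<rho>/2 * (norm (un - v))\<^sup>2"
    by (simp add: right_diff_distrib distrib_left)
  then show ?thesis
    using f x z three_point Mp w
    unfolding p_def[symmetric] q_def[symmetric] a_def[symmetric] b_def[symmetric] r_def[symmetric]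
    by simp
qed

text \<open>Every term on the left contains \<delta> once as a factor, apart from quantities bounded
  separately, so an accuracy \<epsilon> in distance enters linearly.\<close>

lemma x_step_error_le:
  fixes M :: "'x::euclidean_space \<Rightarrow> 'h::euclidean_space"
  assumes "psd \<Theta>" "\<Theta> \<preceq> (\<lambda>v. \<theta> *\<^sub>R v)" "linear M" "0 \<le> \<rho>" "0 \<le> \<theta>" "norm \<delta> \<le> \<epsilon>"
  shows "d \<bullet> \<delta> + \<Theta> e \<bullet> \<delta> + \<rho> * (w \<bullet> M \<delta>) + \<Theta> \<delta> \<bullet> p + \<rho> * (M \<delta> \<bullet> M p)
    \<le> \<epsilon> * (norm d + \<theta> * norm e + \<rho> * onorm M * norm w + \<theta> * norm p + \<rho> * (onorm M)\<^sup>2 * norm p)"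
proof -
  have bM: "bounded_linear M" using assms(3) by (simp add: linear_conv_bounded_linear)
  have m: "0 \<le> onorm M" by (rule onorm_pos_le[OF bM])
  have M\<delta>: "norm (M \<delta>) \<le> onorm M * norm \<delta>" and Mp: "norm (M p) \<le> onorm M * norm p"
    using onorm[OF bM] by auto
  have "d \<bullet> \<delta> \<le> norm d * norm \<delta>" by (rule norm_cauchy_schwarz)
  moreover have "\<Theta> e \<bullet> \<delta> \<le> \<theta> * (norm e * norm \<delta>)" "\<Theta> \<delta> \<bullet> p \<le> \<theta> * (norm \<delta> * norm p)"
    using psd_inner_le[OF assms(1,2)] by auto
  moreover have "\<rho> * (w \<bullet> M \<delta>) \<le> \<rho> * (norm w * (onorm M * norm \<delta>))"
    using M\<delta> assms(4)
    by (intro mult_left_mono order_trans[OF norm_cauchy_schwarz]) auto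
  moreover have "\<rho> * (M \<delta> \<bullet> M p) \<le> \<rho> * ((onorm M * norm \<delta>) * (onorm M * norm p))"
    using M\<delta> Mp assms(4) m
    by (intro mult_left_mono order_trans[OF norm_cauchy_schwarz] mult_mono) auto
  ultimately have "d \<bullet> \<delta> + \<Theta> e \<bullet> \<delta> + \<rho> * (w \<bullet> M \<delta>) + \<Theta> \<delta> \<bullet> p + \<rho> * (M \<delta> \<bullet> M p)
    \<le> norm \<delta> * (norm d + \<theta> * norm e + \<rho> * onorm M * norm w + \<theta> * norm p + \<rho> * (onorm M)\<^sup>2 * norm p)"
    by (simp add: algebra_simps power2_eq_square)
  also have "\<dots> \<le> \<epsilon> * (norm d + \<theta> * norm e + \<rho> * onorm M * norm w + \<theta> * norm p + \<rho> * (onorm M)\<^sup>2 * norm p)"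
    using assms(4-6) m by (intro mult_right_mono add_nonneg_nonneg mult_nonneg_nonneg) auto
  finally show ?thesis .
qed

text \<open>From \<open>s \<le> 1 + s * s\<close>. A bound affine in \<open>D\<close>, coarser than
  the square root for large \<open>D\<close>, matches the error term of the perturbed
  recursion.\<close>

lemma norm_le_if_weighted_square_le:
  assumes "0 < \<alpha>" "\<alpha>/2 * (norm v)\<^sup>2 \<le> D"
  shows "norm v \<le> 1 + 2 / \<alpha> * D"
proof -
  have "0 \<le> (norm v - 1)\<^sup>2" "0 \<le> (norm v)\<^sup>2" by auto
  then have "norm v \<le> 1 + (norm v)\<^sup>2"
    using norm_ge_zero[of v] by (simp add: power2_diff del: norm_ge_zero)
  also have "(norm v)\<^sup>2 \<le> 2 / \<alpha> * D" using assms by (simp add: field_simps)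
  finally show ?thesis by simp
qed

text \<open>Jensen's inequality with equal weights; the average begins at index 2, so after
  reindexing its terms are the \<open>s (k + 1)\<close>.\<close>

lemma convex_on_avg_le:
  assumes "convex_on C h" "t \<ge> 1" "\<And>k. k \<ge> 1 \<Longrightarrow> s k \<in> C"
  shows "real t * h (avg s t) \<le> (\<Sum>k = 1..t. h (s (k + 1)))"
proof -
  have shift: "{2..t + 1} = Suc ` {1..t}" by (simp add: image_Suc_atLeastAtMost numeral_2_eq_2)
  have "h (\<Sum>k\<in>{1..t}. (1 / real t) *\<^sub>R s (k + 1)) \<le> (\<Sum>k\<in>{1..t}. 1 / real t * h (s (k + 1)))"
    using assms by (intro convex_on_sum) auto
  moreover have "avg s t = (\<Sum>k\<in>{1..t}. (1 / real t) *\<^sub>R s (k + 1))"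
    unfolding avg_def shift
    by (simp add: sum.reindex scaleR_sum_right del: image_Suc_atLeastAtMost sum.cl_ivl_Suc)
  ultimately show ?thesis
    using assms(2) by (simp add: sum_divide_distrib[symmetric] field_simps)
qed

lemma opt_value_eq:
  assumes "primal_optimal X Z M N f g xs zs"
  shows "opt_value X Z M N f g = f xs + g zs"
proof -
  have "(xs, zs) \<in> feasible X Z M N"
    and "\<And>x z. (x, z) \<in> feasible X Z M N \<Longrightarrow> f xs + g zs \<le> f x + g z"
    using assms by (auto simp: primal_optimal_def is_arg_min_def not_less)
  then show ?thesis
    unfolding opt_value_def by (intro cInf_eq_minimum) (auto intro!: image_eqI[of _ _ "(xs, zs)"])
qed

theorem corollary1:
  fixes X :: "'x::euclidean_space set" and Z :: "'z::euclidean_space set"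
    and U :: "'h::euclidean_space set"
    and M :: "'x \<Rightarrow> 'h" and N :: "'z \<Rightarrow> 'h"
    and f :: "'x \<Rightarrow> real" and gradf :: "'x \<Rightarrow> 'x" and Hf :: "'x \<Rightarrow> 'x \<Rightarrow>\<^sub>L 'x"
    and g :: "'z \<Rightarrow> real"
    and \<rho> \<sigma> \<eta> Lf \<theta>max \<theta>min \<nu> :: real
    and \<Theta> :: "nat \<Rightarrow> 'x \<Rightarrow> 'x"
    and \<epsilon>x \<epsilon>z \<zeta> :: "nat \<Rightarrow> real"
    and x :: "nat \<Rightarrow> 'x" and z :: "nat \<Rightarrow> 'z" and u :: "nat \<Rightarrow> 'h"
    and xs :: 'x and zs :: 'z and us :: 'h
  assumes X: "closed X" "convex X"
    and Z: "closed Z" "convex Z"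
    and U: "closed U" "convex U"
    and lin: "linear M" "linear N"
    and f_convex: "convex_on UNIV f"
    and f_C2: "twice_cont_diff f gradf Hf"
    and f_smooth: "\<exists>L. L-lipschitz_on UNIV gradf"
    and f_rel_smooth: "relatively_smooth X f gradf Hf Lf"
    and params: "\<rho> > 0" "\<sigma> > 0" "\<eta> = Lf"
    and Theta: "\<And>k. k \<ge> 1 \<Longrightarrow> \<Theta> k = nys_metric \<eta> \<sigma> (Hf (x k))"
    and run: "geni_admm X Z M N gradf g \<rho> \<Theta> \<epsilon>x \<epsilon>z x z u"
    and init: "u 1 = 0" "M (x 1) = - N (z 1)"
    and optimal: "primal_optimal X Z M N f g xs zs"
    and saddle: "saddle_point X Z U (lagrangian M N f g \<rho>) xs zs us"
    and g_convex: "convex_on Z g" and g_lsc: "lsc_on Z g"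
    and eps_x_summable: "summable (\<lambda>k. \<epsilon>x (k + 1))"
    and eps_z_summable: "summable (\<lambda>k. sqrt (\<epsilon>z (k + 1)))"
    and const_pos: "\<theta>max > 0" "\<theta>min > 0" "\<nu> > 0"
    and Theta_upper: "\<And>k. k \<ge> 1 \<Longrightarrow> \<Theta> k \<preceq> (\<lambda>v. \<theta>max *\<^sub>R v)"
    and Theta_lower: "\<And>k. k \<ge> 1 \<Longrightarrow> (\<lambda>v. \<theta>min *\<^sub>R v) \<preceq> \<Theta> k"
    and N_lower: "(\<lambda>v. \<nu> *\<^sub>R v) \<preceq> (\<lambda>v. \<rho> *\<^sub>R adjoint N (N v))"
    and zeta_nonneg: "\<And>k. k \<ge> 1 \<Longrightarrow> \<zeta> k \<ge> 0"
    and zeta_summable: "summable (\<lambda>k. \<zeta> (k + 1))"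
    and zeta: "\<And>k. k \<ge> 2 \<Longrightarrow>
        wnorm_sq (\<Theta> k) (x k - xs) \<le> (1 + \<zeta> (k - 1)) * wnorm_sq (\<Theta> (k - 1)) (x k - xs)"
  shows "\<exists>Cx Cz C\<zeta>. Cx > 0 \<and> Cz > 0 \<and> C\<zeta> > 0 \<and>
     (let \<E>x = (\<Sum>k. \<epsilon>x (k + 1));
          \<E>z = (\<Sum>k. sqrt (\<epsilon>z (k + 1)));
          \<tau>\<zeta> = (\<Prod>k. 1 + \<zeta> (k + 2));
          \<E>\<zeta> = \<tau>\<zeta> * (\<Sum>k. \<zeta> (k + 1));
          du = norm (u 1 - us);
          \<Gamma> = 1/2 * wnorm_sq (\<Theta> 1) (x 1 - xs)
              + 1/2 * wnorm_sq (\<lambda>v. \<rho> *\<^sub>R adjoint N (N v)) (z 1 - zs)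
              + Cx * \<E>x + Cz * \<E>z + C\<zeta> * \<E>\<zeta>
      in \<forall>t\<ge>1.
           f (avg x t) + g (avg z t) - opt_value X Z M N f g \<le> \<Gamma> / real t \<and>
           norm (M (avg x t) + N (avg z t)) \<le> 2 / real t * sqrt (\<Gamma> / \<rho> + du\<^sup>2))"
proof -

  \<comment> \<open>Properties of the iterates and of the optimal point\<close>
  have step: "psd (\<Theta> k)" "0 \<le> \<epsilon>x k" "0 \<le> \<epsilon>z k" "x (k + 1) \<in> X" "z (k + 1) \<in> Z"
      "u (k + 1) = u k + M (x (k + 1)) + N (z (k + 1))"
    and x_step: "\<exists>xex. is_arg_min (x_objective M N gradf \<rho> (\<Theta> k) (x k) (z k) (u k)) (\<lambda>y. y \<in> X) xex \<and>
               norm (x (k + 1) - xex) \<le> \<epsilon>x k"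
    and z_step: "\<And>w. w \<in> Z \<Longrightarrow> z_objective M N g \<rho> (x (k + 1)) (u k) (z (k + 1))
                 \<le> z_objective M N g \<rho> (x (k + 1)) (u k) w + \<epsilon>z k"
    if "k \<ge> 1" for k
    using run that unfolding geni_admm_def is_arg_min_def
    by (blast, blast, blast, blast, blast, blast, blast, force)
  have x_in: "x k \<in> X" if "k \<ge> 1" for k
    using run step(4)[of "k - 1"] that by (cases "k = 1") (auto simp: geni_admm_def)
  have opt: "xs \<in> X" "zs \<in> Z" "M xs + N zs = 0"
    using optimal by (auto simp: primal_optimal_def is_arg_min_def feasible_def)
  obtain L where L: "L-lipschitz_on UNIV gradf" using f_smooth by blast
  then have L0: "0 \<le> L" by (rule lipschitz_on_nonneg)
  have "0 < Lf" using f_rel_smooth by (simp add: relatively_smooth_def)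

  \<comment> \<open>The Lyapunov function and the norms it controls\<close>
  define R where "R k = 1/2 * wnorm_sq (\<Theta> k) (x k - xs) + \<rho>/2 * (norm (N (z k - zs)))\<^sup>2" for k
  \<comment> \<open>\<open>R\<close> is the part that does not depend on the dual point; it is
    reused below with every \<open>v\<close>, while \<open>D\<close> fixes
    \<open>v = us\<close>.\<close>
  define D where "D k = R k + \<rho>/2 * (norm (u k - us))\<^sup>2" for k
  define gap where "gap v k = f (x (k + 1)) - f xs + (g (z (k + 1)) - g zs)
      + \<rho> * (v \<bullet> (M (x (k + 1)) + N (z (k + 1))))" for v k
  define b where "b k = \<epsilon>x k + sqrt (\<epsilon>z k) + \<zeta> k" for k
  have Wpos: "0 \<le> wnorm_sq (\<Theta> k) v" if "k \<ge> 1" for k v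
    using step(1)[OF that] by (simp add: psd_def wnorm_sq_def)
  have Rpos: "0 \<le> R k" if "k \<ge> 1" for k
    using Wpos[OF that] params(1) by (simp add: R_def)
  have Dpos: "0 \<le> D k" if "k \<ge> 1" for k
    using Rpos[OF that] params(1) by (simp add: D_def)
  have Wlow: "\<theta>min * (norm v)\<^sup>2 \<le> wnorm_sq (\<Theta> k) v" if "k \<ge> 1" for k v
    using Theta_lower[OF that]
    by (simp add: loewner_le_def psd_def wnorm_sq_def inner_diff_right power2_norm_eq_inner)
  have Wup: "wnorm_sq (\<Theta> k) v \<le> \<theta>max * (norm v)\<^sup>2" if "k \<ge> 1" for k v
    using Theta_upper[OF that]
    by (simp add: loewner_le_def psd_def wnorm_sq_def inner_diff_right power2_norm_eq_inner)

  \<comment> \<open>Chosen so that \<open>c * (1 + D k)\<close> dominates the affine bounds with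
    slopes \<open>2 / \<theta>min\<close> and \<open>2 / \<rho>\<close>.\<close>
  define c where "c = 1 + 2 / \<theta>min + 2 / \<rho>"
  \<comment> \<open>Bounds every \<open>sqrt (\<epsilon>z k)\<close> with \<open>k \<ge> 1\<close>;
    the added 1 keeps the balancing step length at most 1.\<close>
  define cz where "cz = 1 + (\<Sum>k. sqrt (\<epsilon>z (k + 1)))"
  have c0: "0 < c" using const_pos params by (simp add: c_def add_pos_pos)
  have norms: "norm (x k - xs) \<le> c * (1 + D k)" "norm (N (z k - zs)) \<le> c * (1 + D k)"
      "norm (u k - us) \<le> c * (1 + D k)" if k: "k \<ge> 1" for k
  proof -
    have sq: "\<theta>min/2 * (norm (x k - xs))\<^sup>2 \<le> D k" "\<rho>/2 * (norm (N (z k - zs)))\<^sup>2 \<le> D k"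
        "\<rho>/2 * (norm (u k - us))\<^sup>2 \<le> D k"
      using Wlow[OF k, of "x k - xs"] Wpos[OF k, of "x k - xs"] params(1)
        zero_le_power2[of "norm (N (z k - zs))"] zero_le_power2[of "norm (u k - us)"]
      by (simp_all add: D_def R_def add_nonneg_nonneg add_increasing add_increasing2)
    have q: "0 \<le> 2 / \<theta>min" "0 \<le> 2 / \<rho>" using const_pos params by auto
    then have qD: "0 \<le> 2 / \<theta>min * D k" "0 \<le> 2 / \<rho> * D k"
      using Dpos[OF k] mult_nonneg_nonneg by blast+
    have "c * (1 + D k) = 1 + 2 / \<theta>min + 2 / \<rho> + D k + 2 / \<theta>min * D k + 2 / \<rho> * D k"
      unfolding c_def by (simp add: distrib_left distrib_right add_divide_distrib)
    then have "1 + 2 / \<theta>min * D k \<le> c * (1 + D k)" "1 + 2 / \<rho> * D k \<le> c * (1 + D k)"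
      using q qD Dpos[OF k] by linarith+
    then show "norm (x k - xs) \<le> c * (1 + D k)" "norm (N (z k - zs)) \<le> c * (1 + D k)"
      "norm (u k - us) \<le> c * (1 + D k)"
      using norm_le_if_weighted_square_le[OF const_pos(2) sq(1)]
        norm_le_if_weighted_square_le[OF params(1) sq(2)]
        norm_le_if_weighted_square_le[OF params(1) sq(3)] by linarith+
  qed
  have sqrt_eps_z: "sqrt (\<epsilon>z k) \<le> cz" if "k \<ge> 1" for k
  proof -
    have "sqrt (\<epsilon>z (k - 1 + 1)) \<le> (\<Sum>k. sqrt (\<epsilon>z (k + 1)))"
      using sum_le_suminf[OF eps_z_summable, of "{k - 1}"] step(3) by simp
    with that show ?thesis by (simp add: cz_def)
  qed
  have cz: "1 \<le> cz"
    unfolding cz_def using suminf_nonneg[OF eps_z_summable] step(3) by simp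

  \<comment> \<open>One-step decrease for an arbitrary dual point\<close>
  define m where "m = onorm M"
  have m: "0 \<le> m"
    unfolding m_def using lin(1) by (intro onorm_pos_le) (simp add: linear_conv_bounded_linear)
  \<comment> \<open>The summands follow the five terms of the error bound for the x-step: gradient,
    displacement, penalty argument, and the two terms in the distance to \<open>xs\<close>.\<close>
  define A1 where "A1 = (norm (gradf xs) + L * c) + \<theta>max * (2 * c) + \<rho> * m * (norm us + 3 * c)
      + \<theta>max * c + \<rho> * m\<^sup>2 * c"
  have A1: "0 \<le> A1"
    unfolding A1_def using L0 c0 const_pos params m
    by (intro add_nonneg_nonneg mult_nonneg_nonneg) auto
  define A where "A = A1 + cz + \<theta>max / \<theta>min"

  have main: "gap v k \<le> R k + \<rho>/2 * (norm (u k - v))\<^sup>2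
      - (R (k + 1) + \<rho>/2 * (norm (u (k + 1) - v))\<^sup>2) + A * b k * (1 + D k + D (k + 1))"
    if k: "k \<ge> 1" for k v
  proof -
    \<comment> \<open>Common scale of all errors: being at least 1, it also absorbs constants such
      as \<open>norm us\<close>.\<close>
    define S where "S = 1 + D k + D (k + 1)"
    have k1: "k + 1 \<ge> 1" by simp
    have S: "1 \<le> S" "D (k + 1) \<le> S" using Dpos[OF k] Dpos[OF k1] by (simp_all add: S_def)
    have cS: "c * (1 + D k) \<le> c * S" "c * (1 + D (k + 1)) \<le> c * S"
      using c0 Dpos[OF k] Dpos[OF k1] by (simp_all add: S_def)
    have nS: "norm (x k - xs) \<le> c * S" "norm (N (z k - zs)) \<le> c * S"
      "norm (x (k + 1) - xs) \<le> c * S" "norm (N (z (k + 1) - zs)) \<le> c * S"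
      "norm (u (k + 1) - us) \<le> c * S"
      using norms[OF k] norms[OF k1] cS by linarith+
    obtain xex where xex: "is_arg_min (x_objective M N gradf \<rho> (\<Theta> k) (x k) (z k) (u k)) (\<lambda>y. y \<in> X) xex"
      "norm (x (k + 1) - xex) \<le> \<epsilon>x k" using x_step[OF k] by blast
    define G where "G = gradf (x k)"
    define w where "w = M (x (k + 1)) + N (z k) + u k"

    have grad_S: "norm G \<le> (norm (gradf xs) + L * c) * S"
    proof -
      have "norm G \<le> norm (gradf xs) + norm (gradf (x k) - gradf xs)"
        unfolding G_def by (rule norm_triangle_sub)
      also have "norm (gradf (x k) - gradf xs) \<le> L * norm (x k - xs)"
        using lipschitz_onD[OF L, of "x k" xs] by (simp add: dist_norm)
      also have "L * norm (x k - xs) \<le> L * (c * S)" using nS L0 by (intro mult_left_mono)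
      also have "norm (gradf xs) \<le> norm (gradf xs) * S" using S mult_left_mono[of 1 S] by simp
      finally show ?thesis by (simp add: algebra_simps)
    qed
    have diff_S: "norm (x (k + 1) - x k) \<le> 2 * c * S"
      using norm_triangle_ineq4[of "x (k + 1) - xs" "x k - xs"] nS by simp
    have w_S: "norm w \<le> (norm us + 3 * c) * S"
    proof -
      \<comment> \<open>The multiplier update replaces \<open>M (x (k + 1)) + u k\<close> by
        \<open>u (k + 1) - N (z (k + 1))\<close>, leaving only distances that \<open>D k\<close> and
        \<open>D (k + 1)\<close> control.\<close>
      have "w = us + (u (k + 1) - us) + N (z k - zs) - N (z (k + 1) - zs)"
        using step(6)[OF k] by (simp add: w_def linear_diff[OF lin(2)])
      then have "norm w \<le> norm us + norm (u (k + 1) - us) + norm (N (z k - zs)) + norm (N (z (k + 1) - zs))"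
        using norm_triangle_ineq4[of "us + (u (k + 1) - us) + N (z k - zs)" "N (z (k + 1) - zs)"]
          norm_triangle_ineq[of "us + (u (k + 1) - us)" "N (z k - zs)"]
          norm_triangle_ineq[of us "u (k + 1) - us"]
        by (simp del: add_diff_cancel_left' add_diff_cancel_right' diff_add_cancel add_diff_cancel)
      also have "\<dots> \<le> norm us * S + c * S + c * S + c * S"
        using nS S mult_left_mono[of 1 S "norm us"] by (intro add_mono) auto
      finally show ?thesis by (simp add: algebra_simps)
    qed
    define ex where "ex = \<epsilon>x k * (norm G + \<theta>max * norm (x (k + 1) - x k) + \<rho> * m * norm w
        + \<theta>max * norm (x (k + 1) - xs) + \<rho> * m\<^sup>2 * norm (x (k + 1) - xs))"
    define ez where "ez = sqrt (\<epsilon>z k) * (\<rho>/2 * (norm (N (z (k + 1) - zs)))\<^sup>2 + cz)"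
    have "ex \<le> \<epsilon>x k * ((norm (gradf xs) + L * c) * S + \<theta>max * (2 * c * S)
        + \<rho> * m * ((norm us + 3 * c) * S) + \<theta>max * (c * S) + \<rho> * m\<^sup>2 * (c * S))"
      unfolding ex_def using grad_S diff_S w_S nS step(2)[OF k] const_pos params m
      by (intro mult_left_mono add_mono) auto
    then have ex: "ex \<le> \<epsilon>x k * (A1 * S)" by (simp add: A1_def algebra_simps)
    have ez: "ez \<le> sqrt (\<epsilon>z k) * (cz * S)"
    proof -
      have "\<rho>/2 * (norm (N (z (k + 1) - zs)))\<^sup>2 \<le> D (k + 1)"
        using Wpos[OF k1, of "x (k + 1) - xs"] params(1) by (simp add: D_def R_def)
      moreover have "S - 1 \<le> cz * (S - 1)" using cz S mult_right_mono[of 1 cz "S - 1"] by simp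
      ultimately have "\<rho>/2 * (norm (N (z (k + 1) - zs)))\<^sup>2 + cz \<le> cz * S"
        using Dpos[OF k] by (simp add: S_def algebra_simps)
      then show ?thesis unfolding ez_def using step(3)[OF k] by (intro mult_left_mono) auto
    qed

    \<comment> \<open>Relative smoothness from \<open>x k\<close> to the new iterate and convexity
      from \<open>x k\<close> to \<open>xs\<close> share the gradient \<open>G\<close>. The
      \<sigma>-part of \<open>\<Theta> k\<close> only enlarges the quadratic term.\<close>
    have "f (x (k + 1)) - f xs \<le> G \<bullet> (x (k + 1) - xs) + 1/2 * wnorm_sq (\<Theta> k) (x (k + 1) - x k)"
    proof -
      have "f (x (k + 1)) \<le> f (x k) + G \<bullet> (x (k + 1) - x k)
          + Lf / 2 * wnorm_sq (blinfun_apply (Hf (x k))) (x (k + 1) - x k)"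
        using f_rel_smooth x_in[OF k] step(4)[OF k] by (simp add: relatively_smooth_def G_def)
      moreover have "Lf / 2 * wnorm_sq (blinfun_apply (Hf (x k))) (x (k + 1) - x k)
          \<le> 1/2 * wnorm_sq (\<Theta> k) (x (k + 1) - x k)"
        using \<open>0 < Lf\<close> params(2,3)
        by (simp add: Theta[OF k] nys_metric_def wnorm_sq_def inner_add_right distrib_left)
      moreover have "f (x k) + G \<bullet> (xs - x k) \<le> f xs"
        unfolding G_def using f_convex f_C2
        by (intro convex_on_above_gradient) (auto simp: twice_cont_diff_def)
      ultimately show ?thesis by (simp add: inner_diff_right)
    qed
    moreover have "G \<bullet> (x (k + 1) - xs) + \<Theta> k (x (k + 1) - x k) \<bullet> (x (k + 1) - xs)
        + \<rho> * (w \<bullet> M (x (k + 1) - xs)) \<le> ex"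
      using inexact_x_step[OF step(1)[OF k] lin(1) X(2) less_imp_le[OF params(1)] opt(1) xex(1), of "x (k + 1)"]
        x_step_error_le[OF step(1)[OF k] Theta_upper[OF k] lin(1) less_imp_le[OF params(1)]
          less_imp_le[OF const_pos(1)] xex(2), of G "x (k + 1) - x k" w "x (k + 1) - xs"]
      unfolding ex_def m_def w_def G_def by linarith
    moreover have "g (z (k + 1)) - g zs + \<rho> * (u (k + 1) \<bullet> N (z (k + 1) - zs)) \<le> ez"
      unfolding ez_def step(6)[OF k]
      using inexact_z_step[OF lin(2) g_convex less_imp_le[OF params(1)] step(5)[OF k] opt(2)
          z_step[OF k] step(3)[OF k] sqrt_eps_z[OF k] cz] .
    ultimately have lyap: "gap v k
     \<le> 1/2 * wnorm_sq (\<Theta> k) (x k - xs) + \<rho>/2 * (norm (N (z k - zs)))\<^sup>2 + \<rho>/2 * (norm (u k - v))\<^sup>2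
       - (1/2 * wnorm_sq (\<Theta> k) (x (k + 1) - xs) + \<rho>/2 * (norm (N (z (k + 1) - zs)))\<^sup>2
          + \<rho>/2 * (norm (u (k + 1) - v))\<^sup>2) + ex + ez"
      unfolding gap_def w_def
      using lyapunov_step[OF step(1)[OF k] lin less_imp_le[OF params(1)] opt(3) step(6)[OF k]] by blast

    \<comment> \<open>Change of metric from \<open>\<Theta> k\<close> to
      \<open>\<Theta> (k + 1)\<close>. The excess is \<open>\<zeta> k\<close> times the old metric,
      compared with \<open>D (k + 1)\<close>, which uses the new one, through
      \<open>\<theta>max / \<theta>min\<close>.\<close>
    have "1/2 * wnorm_sq (\<Theta> (k + 1)) (x (k + 1) - xs)
       \<le> 1/2 * wnorm_sq (\<Theta> k) (x (k + 1) - xs) + \<zeta> k * (\<theta>max / \<theta>min * S)"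
    proof -
      have "1/2 * wnorm_sq (\<Theta> k) (x (k + 1) - xs) \<le> \<theta>max * (1/2 * (norm (x (k + 1) - xs))\<^sup>2)"
        using Wup[OF k, of "x (k + 1) - xs"] by simp
      also have "1/2 * (norm (x (k + 1) - xs))\<^sup>2 \<le> S / \<theta>min"
      proof -
        have "\<theta>min * (norm (x (k + 1) - xs))\<^sup>2 \<le> 2 * D (k + 1)"
          using Wlow[OF k1, of "x (k + 1) - xs"] params(1) by (simp add: D_def R_def add_increasing2)
        then show ?thesis using S const_pos(2) by (simp add: field_simps)
      qed
      finally have "1/2 * wnorm_sq (\<Theta> k) (x (k + 1) - xs) \<le> \<theta>max / \<theta>min * S"
        using const_pos(1) by simp
      then have "\<zeta> k * (1/2 * wnorm_sq (\<Theta> k) (x (k + 1) - xs)) \<le> \<zeta> k * (\<theta>max / \<theta>min * S)"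
        using zeta_nonneg[OF k] by (intro mult_left_mono)
      then show ?thesis using zeta[of "k + 1"] k by (simp add: algebra_simps)
    qed
    then have "gap v k \<le> R k + \<rho>/2 * (norm (u k - v))\<^sup>2
      - (R (k + 1) + \<rho>/2 * (norm (u (k + 1) - v))\<^sup>2)
      + (\<epsilon>x k * (A1 * S) + sqrt (\<epsilon>z k) * (cz * S) + \<zeta> k * (\<theta>max / \<theta>min * S))"
      using lyap ex ez unfolding R_def by linarith
    also have "\<epsilon>x k * (A1 * S) + sqrt (\<epsilon>z k) * (cz * S) + \<zeta> k * (\<theta>max / \<theta>min * S)
        \<le> \<epsilon>x k * (A * S) + sqrt (\<epsilon>z k) * (A * S) + \<zeta> k * (A * S)"
    proof -
      have "0 \<le> \<theta>max / \<theta>min" using const_pos by simp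
      then have "A1 \<le> A" "cz \<le> A" "\<theta>max / \<theta>min \<le> A" unfolding A_def using A1 cz by linarith+
      then show ?thesis
        using S step(2,3)[OF k] zeta_nonneg[OF k] by (intro add_mono mult_left_mono mult_right_mono) auto
    qed
    also have "\<dots> = A * b k * S" by (simp add: b_def algebra_simps)
    finally show ?thesis by (simp add: S_def)
  qed

  \<comment> \<open>Boundedness of the Lyapunov function and telescoping\<close>
  have A0: "0 < A" unfolding A_def using A1 cz const_pos by (simp add: add_pos_pos add_nonneg_pos)
  have b0: "0 \<le> b k" if "k \<ge> 1" for k using step(2,3)[OF that] zeta_nonneg[OF that] by (simp add: b_def)
  have b_summable: "summable (\<lambda>k. b (k + 1))"
    unfolding b_def by (intro summable_add eps_x_summable eps_z_summable zeta_summable)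
  \<comment> \<open>Feasibility of \<open>(xs, zs)\<close> removes its multiplier term, so the gap
    at \<open>us\<close> is a difference of Lagrangian values.\<close>
  have gap_us: "0 \<le> gap us k" if "k \<ge> 1" for k
  proof -
    have "lagrangian M N f g \<rho> xs zs us \<le> lagrangian M N f g \<rho> (x (k + 1)) (z (k + 1)) us"
      using saddle step(4,5)[OF that] by (auto simp: saddle_point_def)
    then show ?thesis by (simp add: lagrangian_def gap_def opt(3))
  qed
  obtain B where B: "\<And>k. D (k + 1) \<le> B"
  proof (rule perturbed_recursion_bounded)
    show "D (Suc k + 1) \<le> D (k + 1) + A * b (k + 1) * (1 + D (k + 1) + D (Suc k + 1))" for k
      using main[of "k + 1" us] gap_us[of "k + 1"] by (simp add: D_def)
    show "summable (\<lambda>k. A * b (k + 1))" by (intro summable_mult b_summable)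
  qed (use Dpos A0 b0 in auto)
  \<comment> \<open>With \<open>D\<close> bounded, the error factor becomes one constant, the same
    for all \<open>k\<close>, \<open>t\<close> and \<open>v\<close>.\<close>
  define C where "C = A * (1 + 2 * B)"
  have "0 \<le> B" using B[of 0] Dpos[of 1] by simp
  then have C0: "0 < C" using A0 by (simp add: C_def)
  have step_C: "gap v k \<le> R k + \<rho>/2 * (norm (u k - v))\<^sup>2
      - (R (k + 1) + \<rho>/2 * (norm (u (k + 1) - v))\<^sup>2) + C * b k" if k: "k \<ge> 1" for k v
  proof -
    have "1 + D k + D (k + 1) \<le> 1 + 2 * B" using B[of "k - 1"] B[of k] k by simp
    then have "A * b k * (1 + D k + D (k + 1)) \<le> A * b k * (1 + 2 * B)"
      using A0 b0[OF k] by (intro mult_left_mono) auto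
    then show ?thesis using main[OF k, of v] by (simp add: C_def algebra_simps)
  qed
  have sum_gap: "(\<Sum>k = 1..t. gap v k) \<le> R 1 + \<rho>/2 * (norm (u 1 - v))\<^sup>2
      - (R (t + 1) + \<rho>/2 * (norm (u (t + 1) - v))\<^sup>2) + C * (\<Sum>k = 1..t. b k)" for t v
  proof (induction t)
    case (Suc t)
    then show ?case using step_C[of "Suc t" v] by (simp add: distrib_left)
  qed simp

  \<comment> \<open>The constant \<Gamma>\<close>
  define Ex Ez E\<zeta> where "Ex = (\<Sum>k. \<epsilon>x (k + 1))" and "Ez = (\<Sum>k. sqrt (\<epsilon>z (k + 1)))"
    and "E\<zeta> = (\<Prod>k. 1 + \<zeta> (k + 2)) * (\<Sum>k. \<zeta> (k + 1))"
  define \<Gamma> where "\<Gamma> = R 1 + C * Ex + C * Ez + C * E\<zeta>"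
  have sum_b: "(\<Sum>k = 1..t. b k) \<le> Ex + Ez + E\<zeta>" for t
  proof -
    have "(\<Sum>k = 1..t. b k) = (\<Sum>k<t. b (k + 1))"
      by (rule sum.reindex_bij_witness[of _ "\<lambda>k. k + 1" "\<lambda>k. k - 1"]) auto
    also have "\<dots> \<le> (\<Sum>k. b (k + 1))" using b0 by (intro sum_le_suminf b_summable) auto
    also have "\<dots> = Ex + Ez + (\<Sum>k. \<zeta> (k + 1))"
      unfolding b_def Ex_def Ez_def
      by (simp only: suminf_add[symmetric] eps_x_summable eps_z_summable zeta_summable summable_add)
    \<comment> \<open>The infinite product converges with factors at least 1, so multiplying the sum
      by it only enlarges the bound.\<close>
    also have "(\<Sum>k. \<zeta> (k + 1)) \<le> E\<zeta>"
    proof -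
      have "summable (\<lambda>k. \<zeta> (k + 2))" using summable_ignore_initial_segment[OF zeta_summable, of 1] by simp
      then have "convergent_prod (\<lambda>k. 1 + \<zeta> (k + 2))"
        using zeta_nonneg
        by (intro abs_convergent_prod_imp_convergent_prod summable_imp_abs_convergent_prod) simp
      then have "1 \<le> (\<Prod>k. 1 + \<zeta> (k + 2))"
        using zeta_nonneg by (intro prodinf_nonneg convergent_prod_has_prod) auto
      moreover have "0 \<le> (\<Sum>k. \<zeta> (k + 1))" using zeta_nonneg by (intro suminf_nonneg zeta_summable) auto
      ultimately show ?thesis unfolding E\<zeta>_def by (simp add: mult_le_cancel_right1)
    qed
    finally show ?thesis by simp
  qed
  have sum_\<Gamma>: "(\<Sum>k = 1..t. gap v k) + \<rho>/2 * (norm (u (t + 1) - v))\<^sup>2 \<le> \<Gamma> + \<rho>/2 * (norm (u 1 - v))\<^sup>2" for t v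
    using sum_gap[of v t] mult_left_mono[OF sum_b[of t] less_imp_le[OF C0]] Rpos[of "t + 1"]
    by (simp add: \<Gamma>_def distrib_left)

  \<comment> \<open>Objective bound, with dual point 0\<close>
  have "f (avg x t) + g (avg z t) - opt_value X Z M N f g \<le> \<Gamma> / real t" if t: "t \<ge> 1" for t
  proof -
    have "real t * f (avg x t) \<le> (\<Sum>k = 1..t. f (x (k + 1)))"
      using t by (intro convex_on_avg_le[OF f_convex]) auto
    moreover have z_in: "z k \<in> Z" if "k \<ge> 1" for k
      using run step(5)[of "k - 1"] that by (cases "k = 1") (auto simp: geni_admm_def)
    then have "real t * g (avg z t) \<le> (\<Sum>k = 1..t. g (z (k + 1)))"
      using t by (intro convex_on_avg_le[OF g_convex]) auto
    moreover have "(\<Sum>k = 1..t. gap 0 k) = (\<Sum>k = 1..t. f (x (k + 1))) + (\<Sum>k = 1..t. g (z (k + 1)))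
        - real t * (f xs + g zs)"
      by (simp add: gap_def sum.distrib sum_subtractf distrib_left)
    \<comment> \<open>For \<open>v = 0\<close> the initial dual distance vanishes because
      \<open>u 1 = 0\<close>.\<close>
    moreover have "(\<Sum>k = 1..t. gap 0 k) \<le> \<Gamma>"
    proof -
      have "0 \<le> \<rho>/2 * (norm (u (t + 1) - 0))\<^sup>2" "\<rho>/2 * (norm (u 1 - 0))\<^sup>2 = 0"
        using params(1) init(1) by simp_all
      then show ?thesis using sum_\<Gamma>[of 0 t] by linarith
    qed
    ultimately have "real t * (f (avg x t) + g (avg z t) - (f xs + g zs)) \<le> \<Gamma>"
      by (simp add: algebra_simps)
    then show ?thesis using t by (simp add: opt_value_eq[OF optimal] field_simps)
  qed

  \<comment> \<open>Residual bound, with dual point \<open>us\<close>\<close>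
  moreover have "norm (M (avg x t) + N (avg z t)) \<le> 2 / real t * sqrt (\<Gamma> / \<rho> + (norm (u 1 - us))\<^sup>2)"
    if t: "t \<ge> 1" for t
  proof -
    define p q where "p = norm (u (t + 1) - us)" and "q = norm (u 1 - us)"
    have "(\<Sum>k = 2..t + 1. M (x k) + N (z k)) = u (t + 1) - u 1"
    proof (induction t)
      case (Suc t)
      then show ?case using step(6)[of "Suc t"] by simp
    qed simp
    then have "M (avg x t) + N (avg z t) = (1 / real t) *\<^sub>R (u (t + 1) - u 1)"
      by (simp add: avg_def linear_cmul[OF lin(1)] linear_cmul[OF lin(2)] linear_sum[OF lin(1)]
          linear_sum[OF lin(2)] sum.distrib scaleR_add_right[symmetric] del: sum.cl_ivl_Suc)
    then have "norm (M (avg x t) + N (avg z t)) = 1 / real t * norm (u (t + 1) - u 1)" by simp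
    also have "norm (u (t + 1) - u 1) \<le> p + q"
      unfolding p_def q_def using norm_triangle_ineq4[of "u (t + 1) - us" "u 1 - us"] by simp
    \<comment> \<open>Here the factor 2 arises: \<open>(p + q)\<^sup>2\<close> is at most
      \<open>2 * p\<^sup>2 + 2 * q\<^sup>2\<close>, and the telescoped bound gives
      \<open>p\<^sup>2 \<le> 2 * (\<Gamma> / \<rho>) + q\<^sup>2\<close>.\<close>
    also have "p + q \<le> 2 * sqrt (\<Gamma> / \<rho> + q\<^sup>2)"
    proof -
      have "0 \<le> (\<Sum>k = 1..t. gap us k)" using gap_us by (intro sum_nonneg) auto
      then have "\<rho>/2 * p\<^sup>2 \<le> \<Gamma> + \<rho>/2 * q\<^sup>2" using sum_\<Gamma>[of us t] by (simp add: p_def q_def)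
      then have "p\<^sup>2 \<le> 2 * (\<Gamma> / \<rho>) + q\<^sup>2" using params(1) by (simp add: field_simps)
      then have bound: "2 * p\<^sup>2 + 2 * q\<^sup>2 \<le> 4 * (\<Gamma> / \<rho> + q\<^sup>2)"
        unfolding distrib_left by linarith
      have "(p + q)\<^sup>2 \<le> 2 * p\<^sup>2 + 2 * q\<^sup>2"
        using zero_le_power2[of "p - q"] by (simp add: power2_sum power2_diff)
      from this bound have "(p + q)\<^sup>2 \<le> 4 * (\<Gamma> / \<rho> + q\<^sup>2)" by (rule order_trans)
      then have "((p + q) / 2)\<^sup>2 \<le> \<Gamma> / \<rho> + q\<^sup>2"
        by (simp add: power_divide algebra_simps)
      then have "(p + q) / 2 \<le> sqrt (\<Gamma> / \<rho> + q\<^sup>2)" by (rule real_le_rsqrt)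
      then show ?thesis by simp
    qed
    finally show ?thesis using t by (simp add: q_def mult_left_mono divide_right_mono)
  qed
  moreover have "\<Gamma> = 1/2 * wnorm_sq (\<Theta> 1) (x 1 - xs)
      + 1/2 * wnorm_sq (\<lambda>v. \<rho> *\<^sub>R adjoint N (N v)) (z 1 - zs) + C * Ex + C * Ez + C * E\<zeta>"
    by (simp add: \<Gamma>_def R_def wnorm_sq_def adjoint_works[OF lin(2)] power2_norm_eq_inner)
  ultimately show ?thesis
    \<comment> \<open>The same \<open>C\<close> serves as all three constants.\<close>
    using C0 unfolding Let_def Ex_def Ez_def E\<zeta>_def
    by (intro exI[of _ C]) simp
qed

end
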